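(* Let $\varepsilon \in (0,1)$ and $c > 0$ be constants, and suppose that $\mathrm{ORS}(n, \varepsilon n) \ge \Omega(n^c)$, i.e. there is a constant $C>0$ such that $\mathrm{ORS}(n,\varepsilon n) \ge C n^c$ for all sufficiently large $n$. Then for every fixed $\delta > 0$ we have $\mathrm{RS}(n, \Theta(\varepsilon^{1/\delta} n)) \ge \Omega(n^{c(1-\delta)})$; that is, there are constants $a, b, C' > 0$ (depending on $\varepsilon, c, \delta$) and, for every sufficiently large $n$, an integer $r_n$ with $a\,\varepsilon^{1/\delta} n \le r_n \le b\,\varepsilon^{1/\delta} n$ such that $\mathrm{RS}(n, r_n) \ge C' n^{c(1-\delta)}$.
   Context: A graph $G$ is an $(r,t)$-ordered Ruzsa–Szemerédi (ORS) graph if its edge set can be partitioned into $t$ edge-disjoint matchings $M_1, M_2, \ldots, M_t$, each of size $r$, such that for every $i$, the subgraph of $G$ induced by the vertex set of $M_i$ contains no edge of $M_j$ for any $j > i$. $\mathrm{ORS}(n,r)$ denotes the maximum $t$ for which there exists an $n$-vertex $(r,t)$-ORS graph. A graph $G$ is an $(r,t)$ Ruzsa–Szemerédi (RS) graph if its edge set can be partitioned into $t$ edge-disjoint matchings $M_1,\ldots,M_t$, each of size $r$, such that for every $i$ the subgraph of $G$ induced by the vertex set of $M_i$ is a matching (i.e. each $M_i$ is an induced matching in $G$). $\mathrm{RS}(n,r)$ denotes the maximum $t$ for which there exists an $n$-vertex $(r,t)$-RS graph. When a matching size such as $\varepsilon n$ is not an integer it is understood as rounded to an integer (e.g. $\lfloor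 \varepsilon n\rfloor$). *)

theory Defs
  imports Complex_Main "HOL-Library.Disjoint_Sets"
begin

definition simple_graph :: "'a set \<Rightarrow> 'a set set \<Rightarrow> bool" where
  "simple_graph V E \<longleftrightarrow> finite V \<and> (\<forall>e\<in>E. e \<subseteq> V \<and> card e = 2)"

definition matching :: "'a set set \<Rightarrow> bool" where
  "matching M \<longleftrightarrow> pairwise disjnt M"

definition induced_edges :: "'a set set \<Rightarrow> 'a set \<Rightarrow> 'a set set" where
  "induced_edges E S = {e \<in> E. e \<subseteq> S}"

definition matching_partition ::
    "'a set set \<Rightarrow> nat \<Rightarrow> nat \<Rightarrow> (nat \<Rightarrow> 'a set set) \<Rightarrow> bool" where
  "matching_partition E r t M \<longleftrightarrow>
     (\<forall>i\<in>{1..t}. matching (M i) \<and> card (M i) = r) \<and>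
     disjoint_family_on M {1..t} \<and>
     (\<Union>i\<in>{1..t}. M i) = E"

text \<open>In the next two definitions, \<open>\<Union>(M i)\<close> is the vertex set of the matching \<open>M i\<close>.\<close>

definition ors_graph :: "'a set \<Rightarrow> 'a set set \<Rightarrow> nat \<Rightarrow> nat \<Rightarrow> bool" where
  "ors_graph V E r t \<longleftrightarrow> simple_graph V E \<and>
     (\<exists>M. matching_partition E r t M \<and>
        (\<forall>i\<in>{1..t}. \<forall>j\<in>{1..t}. i < j \<longrightarrow>
            induced_edges E (\<Union>(M i)) \<inter> M j = {}))"

definition rs_graph :: "'a set \<Rightarrow> 'a set set \<Rightarrow> nat \<Rightarrow> nat \<Rightarrow> bool" where
  "rs_graph V E r t \<longleftrightarrow> simple_graph V E \<and>
     (\<exists>M. matching_partition E r t M \<and>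
        (\<forall>i\<in>{1..t}. matching (induced_edges E (\<Union>(M i)))))"

text \<open>The maxima below are over finite nonempty sets whenever \<open>r > 0\<close> (see the lemmas that follow).
  For \<open>r = 0\<close> the sets are unbounded and the values are unspecified.\<close>

definition ORS :: "nat \<Rightarrow> nat \<Rightarrow> nat" where
  "ORS n r = Max {t. \<exists>(V :: nat set) E. card V = n \<and> ors_graph V E r t}"

definition RS :: "nat \<Rightarrow> nat \<Rightarrow> nat" where
  "RS n r = Max {t. \<exists>(V :: nat set) E. card V = n \<and> rs_graph V E r t}"

lemma matching_partition_bound:
  assumes "simple_graph V E" "matching_partition E r t M" "r > 0"
  shows "t \<le> 2 ^ card V"
proof -
  have V: "finite V" and EV: "E \<subseteq> Pow V"
    using assms(1) by (auto simp: simple_graph_def)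
  have fin: "finite E" using EV V finite_subset by auto
  have c: "card (M i) = r" and sub: "M i \<subseteq> E" if "i \<in> {1..t}" for i
    using assms(2) that by (auto simp: matching_partition_def)
  have "card E = (\<Sum>i\<in>{1..t}. card (M i))"
    using assms(2) card_UN_disjoint[of "{1..t}" M] finite_subset[OF sub fin]
    unfolding matching_partition_def disjoint_family_on_def by auto
  also have "\<dots> = t * r" using c by simp
  finally have "t \<le> card E" using assms(3) by simp
  also have "\<dots> \<le> 2 ^ card V"
    using card_mono[OF _ EV] V by (simp add: card_Pow)
  finally show ?thesis .
qed

lemma finite_ORS_set:
  "r > 0 \<Longrightarrow> finite {t. \<exists>(V :: nat set) E. card V = n \<and> ors_graph V E r t}"
  by (rule finite_subset[of _ "{..2 ^ n}"]) (auto simp: ors_graph_def dest: matching_partition_bound)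

lemma finite_RS_set:
  "r > 0 \<Longrightarrow> finite {t. \<exists>(V :: nat set) E. card V = n \<and> rs_graph V E r t}"
  by (rule finite_subset[of _ "{..2 ^ n}"]) (auto simp: rs_graph_def dest: matching_partition_bound)

lemma zero_in_ORS_set: "0 \<in> {t. \<exists>(V :: nat set) E. card V = n \<and> ors_graph V E r t}"
  by (rule CollectI, rule exI[of _ "{..<n}"], rule exI[of _ "{}"])
    (simp add: ors_graph_def simple_graph_def matching_partition_def disjoint_family_on_def)

lemma zero_in_RS_set: "0 \<in> {t. \<exists>(V :: nat set) E. card V = n \<and> rs_graph V E r t}"
  by (rule CollectI, rule exI[of _ "{..<n}"], rule exI[of _ "{}"])
    (simp add: rs_graph_def simple_graph_def matching_partition_def disjoint_family_on_def)

end

theory Submission imports Defs "HOL-Library.FuncSet" begin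

text \<open>Take the \<open>k\<close>-fold tensor power of an ORS graph with matchings \<open>M 1, \<dots>, M t\<close>, where
  \<open>k = \<lceil>1 / \<delta>\<rceil>\<close>. Every tuple \<open>I \<in> {1..t}\<^sup>k\<close> yields a product matching of size
  \<open>(2 r)\<^sup>k / 2\<close> on \<open>N\<^sup>k\<close> vertices. Keep only the tuples with a fixed coordinate sum: two distinct
  ones are incomparable, so in some coordinate the order condition forbids an edge of one product
  matching inside the vertex set of the other, and all matchings become induced. By pigeonhole
  some sum is attained by at least \<open>t\<^sup>k / (k t)\<close> tuples.\<close>

section \<open>Matchings, and RS graphs under reindexing and relabelling\<close>

lemma matching_partner_unique:
  assumes "matching M" "{x, y} \<in> M" "{x, z} \<in> M"
  shows "y = z"
proof -
  have "\<not> disjnt {x, y} {x, z}" by (simp add: disjnt_def)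
  then have "{x, y} = {x, z}"
    using assms unfolding matching_def pairwise_def by metis
  then show ?thesis by (auto simp: doubleton_eq_iff)
qed

lemma card_Union_matching:
  assumes "matching M" "\<And>e. e \<in> M \<Longrightarrow> card e = 2"
  shows "card (\<Union>M) = 2 * card M"
proof -
  have "card (\<Union>M) = sum card M"
    using assms by (intro card_Union_disjoint) (auto simp: matching_def intro: card_ge_0_finite)
  also have "\<dots> = 2 * card M" using assms(2) by simp
  finally show ?thesis .
qed

text \<open>Lets an RS graph be built with any finite index set, here a set of tuples; a bijection
  with \<open>{1..card A}\<close> supplies the numbering that \<open>rs_graph\<close> asks
  for.\<close>

lemma rs_graph_of_indexed_family:
  assumes "simple_graph V (\<Union>i\<in>A. M i)" "finite A"
    and "\<And>i. i \<in> A \<Longrightarrow> matching (M i)" "\<And>i. i \<in> A \<Longrightarrow> card (M i) = r"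
    and "disjoint_family_on M A"
    and "\<And>i. i \<in> A \<Longrightarrow> matching (induced_edges (\<Union>j\<in>A. M j) (\<Union>(M i)))"
  shows "rs_graph V (\<Union>i\<in>A. M i) r (card A)"
proof -
  obtain h where h: "bij_betw h {1..card A} A"
    using ex_bij_betw_nat_finite_1[OF assms(2)] by blast
  have mem: "h i \<in> A" if "i \<in> {1..card A}" for i
    using h that by (auto simp: bij_betw_def)
  have U: "(\<Union>i\<in>{1..card A}. M (h i)) = (\<Union>i\<in>A. M i)"
    using h by (force simp: bij_betw_def)
  have "disjoint_family_on (\<lambda>i. M (h i)) {1..card A}"
    using assms(5) h mem unfolding disjoint_family_on_def bij_betw_def inj_on_def by meson
  then have "matching_partition (\<Union>i\<in>A. M i) r (card A) (\<lambda>i. M (h i))"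
    using assms(3,4) mem U by (auto simp: matching_partition_def)
  then show ?thesis
    unfolding rs_graph_def using assms(1,6) mem by blast
qed

lemma rs_graph_image:
  assumes "rs_graph V E r t" "inj_on f V" "finite W" "f ` V \<subseteq> W"
  shows "rs_graph W ((`) f ` E) r t"
proof -
  obtain M where sg: "simple_graph V E" and mp: "matching_partition E r t M"
    and ind: "\<And>i. i \<in> {1..t} \<Longrightarrow> matching (induced_edges E (\<Union>(M i)))"
    using assms(1) unfolding rs_graph_def by blast
  have EV: "e \<subseteq> V" and E2: "card e = 2" if "e \<in> E" for e
    using sg that by (auto simp: simple_graph_def)
  have injE: "inj_on ((`) f) E"
    using assms(2) EV by (meson PowI inj_on_image_Pow inj_on_subset subsetI)
  have ME: "M i \<subseteq> E" if "i \<in> {1..t}" for i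
    using mp that by (auto simp: matching_partition_def)
  have match: "matching ((`) f ` N)" if "matching N" "N \<subseteq> E" for N
    unfolding matching_def pairwise_def disjnt_def
  proof (intro ballI impI)
    fix a b assume "a \<in> (`) f ` N" "b \<in> (`) f ` N" "a \<noteq> b"
    then obtain d e where "d \<in> N" "e \<in> N" "a = f ` d" "b = f ` e" "d \<noteq> e" by blast
    moreover from this have "d \<inter> e = {}"
      using that by (auto simp: matching_def pairwise_def disjnt_def)
    ultimately show "a \<inter> b = {}"
      using assms(2) EV that(2) inj_on_image_Int[OF assms(2), of d e] by blast
  qed
  have sgW: "simple_graph W ((`) f ` E)"
    unfolding simple_graph_def
  proof (intro conjI ballI)
    fix e assume "e \<in> (`) f ` E"
    then obtain d where d: "d \<in> E" "e = f ` d" by blast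
    show "e \<subseteq> W" using d EV assms(4) by blast
    show "card e = 2"
      using d EV E2 assms(2) by (metis card_image inj_on_subset)
  qed (rule assms(3))
  have mpW: "matching_partition ((`) f ` E) r t (\<lambda>i. (`) f ` M i)"
    unfolding matching_partition_def
  proof (intro conjI ballI)
    fix i assume i: "i \<in> {1..t}"
    show "matching ((`) f ` M i)"
      using mp i ME[OF i] by (intro match) (auto simp: matching_partition_def)
    show "card ((`) f ` M i) = r"
      using mp i card_image[OF inj_on_subset[OF injE ME[OF i]]] by (auto simp: matching_partition_def)
  next
    show "disjoint_family_on (\<lambda>i. (`) f ` M i) {1..t}"
      unfolding disjoint_family_on_def
    proof (intro ballI impI)
      fix i j assume ij: "i \<in> {1..t}" "j \<in> {1..t}" "i \<noteq> j"
      then have "M i \<inter> M j = {}"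
        using mp by (auto simp: matching_partition_def disjoint_family_on_def)
      then show "(`) f ` M i \<inter> (`) f ` M j = {}"
        using inj_on_image_Int[OF injE ME[OF ij(1)] ME[OF ij(2)]] by simp
    qed
  next
    show "(\<Union>i\<in>{1..t}. (`) f ` M i) = (`) f ` E"
      using mp by (auto simp: matching_partition_def)
  qed
  have "matching (induced_edges ((`) f ` E) (\<Union>((`) f ` M i)))" if i: "i \<in> {1..t}" for i
  proof -
    \<comment> \<open>Injectivity pulls containment back along \<open>f\<close>, so taking induced
      edges commutes with the renaming.\<close>
    have "e \<subseteq> \<Union>(M i)" if "e \<in> E" "f ` e \<subseteq> \<Union>((`) f ` M i)" for e
    proof
      fix x assume x: "x \<in> e"
      then obtain d y where "d \<in> M i" "y \<in> d" "f x = f y" using \<open>f ` e \<subseteq> _\<close> by blast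
      moreover from this have "x = y"
        using assms(2) EV \<open>e \<in> E\<close> x ME[OF i] by (metis inj_onD subsetD)
      ultimately show "x \<in> \<Union>(M i)" by blast
    qed
    then have "induced_edges ((`) f ` E) (\<Union>((`) f ` M i)) = (`) f ` induced_edges E (\<Union>(M i))"
      unfolding induced_edges_def by blast
    then show ?thesis
      using match[OF ind[OF i]] by (auto simp: induced_edges_def)
  qed
  then show ?thesis
    unfolding rs_graph_def using sgW mpW by blast
qed

text \<open>\<open>RS\<close> maximises over sets of exactly \<open>n\<close> naturals. A graph on
  at most \<open>n\<close> vertices of any type embeds into \<open>{..<n}\<close>, and
  \<open>r > 0\<close> makes the maximum one over a finite set.\<close>

lemma rs_graph_le_RS:
  assumes "rs_graph V E r t" "card V \<le> n" "r > 0"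
  shows "t \<le> RS n r"
proof -
  have "finite V" using assms(1) by (simp add: rs_graph_def simple_graph_def)
  then obtain f :: "'a \<Rightarrow> nat" where f: "inj_on f V" "f ` V \<subseteq> {..<n}"
    using card_le_inj[of V "{..<n}"] assms(2) by auto
  have "rs_graph {..<n} ((`) f ` E) r t"
    using rs_graph_image[OF assms(1) f(1) _ f(2)] by simp
  then have "t \<in> {t. \<exists>(V :: nat set) E. card V = n \<and> rs_graph V E r t}"
    by (metis (mono_tags, lifting) card_lessThan mem_Collect_eq)
  then show ?thesis
    unfolding RS_def using finite_RS_set[OF assms(3)] by (rule Max_ge[rotated])
qed

lemma ORS_attained:
  assumes "r > 0"
  obtains V :: "nat set" and E where "card V = n" "ors_graph V E r (ORS n r)"
  using Max_in[OF finite_ORS_set[OF assms, of n]] zero_in_ORS_set[of n r]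
  unfolding ORS_def by auto

section \<open>Tensor products of matchings\<close>

text \<open>Vertices are \<open>k\<close>-tuples, encoded as extensional functions so that equality
  is decided on \<open>{..<k}\<close>. For \<open>k > 0\<close>, one edge per factor yields
  \<open>2 ^ (k - 1)\<close> product edges, one for each way of pairing up the endpoints.\<close>

definition tensor_matching ::
    "nat \<Rightarrow> (nat \<Rightarrow> 'a set set) \<Rightarrow> (nat \<Rightarrow> 'a) set set" where
  "tensor_matching k N = {{f, g} |f g. f \<in> extensional {..<k} \<and> g \<in> extensional {..<k} \<and>
     (\<forall>l<k. {f l, g l} \<in> N l)}"

text \<open>Each coordinate of a tuple on the right has a partner in its factor, and the tuple of
  partners is the other end of a product edge.\<close>

lemma Union_tensor_matching:
  assumes "\<And>l e. l < k \<Longrightarrow> e \<in> N l \<Longrightarrow> card e = 2"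
  shows "\<Union>(tensor_matching k N) = (\<Pi>\<^sub>E l\<in>{..<k}. \<Union>(N l))"
proof (intro equalityI subsetI)
  fix f assume "f \<in> \<Union>(tensor_matching k N)"
  then obtain g h where "f = g \<or> f = h" "g \<in> extensional {..<k}" "h \<in> extensional {..<k}"
    and "\<And>l. l < k \<Longrightarrow> {g l, h l} \<in> N l"
    unfolding tensor_matching_def by blast
  then show "f \<in> (\<Pi>\<^sub>E l\<in>{..<k}. \<Union>(N l))"
    by (intro PiE_I) (auto simp: extensional_def)
next
  fix f assume f: "f \<in> (\<Pi>\<^sub>E l\<in>{..<k}. \<Union>(N l))"
  have "\<exists>y. {f l, y} \<in> N l" if l: "l < k" for l
  proof -
    obtain e where e: "e \<in> N l" "f l \<in> e" using f l by (auto simp: PiE_def Pi_def)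
    then show ?thesis using assms[OF l e(1)] by (auto simp: card_2_iff insert_commute)
  qed
  then obtain g where g: "\<And>l. l < k \<Longrightarrow> {f l, g l} \<in> N l" by metis
  have "{f, restrict g {..<k}} \<in> tensor_matching k N"
    unfolding tensor_matching_def mem_Collect_eq using f g
    by (intro exI[of _ f] exI[of _ "restrict g {..<k}"]) (simp add: PiE_def)
  then show "f \<in> \<Union>(tensor_matching k N)" by blast
qed

text \<open>Coordinate 0 already separates the two ends, which is where \<open>k > 0\<close>
  enters.\<close>

lemma card_tensor_edge:
  assumes "k > 0" "\<And>l e. l < k \<Longrightarrow> e \<in> N l \<Longrightarrow> card e = 2" "e \<in> tensor_matching k N"
  shows "card e = 2"
proof -
  obtain f g where e: "e = {f, g}" "\<forall>l<k. {f l, g l} \<in> N l"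
    using assms(3) by (auto simp: tensor_matching_def)
  then have "card {f 0, g 0} = 2" using assms(1,2) by blast
  then have "f \<noteq> g" by auto
  then show ?thesis using e by simp
qed

text \<open>The partner of a tuple is forced coordinate by coordinate, so two edges sharing a tuple
  coincide.\<close>

lemma matching_tensor_matching:
  assumes "\<And>l. l < k \<Longrightarrow> matching (N l)"
  shows "matching (tensor_matching k N)"
proof -
  have uniq: "g = g'" if "g \<in> extensional {..<k}" "g' \<in> extensional {..<k}"
    "\<forall>l<k. {f l, g l} \<in> N l" "\<forall>l<k. {f l, g' l} \<in> N l" for f g g'
  proof (rule extensionalityI[OF that(1,2)])
    fix l assume "l \<in> {..<k}"
    then show "g l = g' l"
      using matching_partner_unique[OF assms, of l "f l"] that(3,4) by simp
  qed
  have *: "\<exists>g. e = {f, g} \<and> g \<in> extensional {..<k} \<and> (\<forall>l<k. {f l, g l} \<in> N l)"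
    if "e \<in> tensor_matching k N" "f \<in> e" for e f
    using that unfolding tensor_matching_def by (auto simp: insert_commute)
  show ?thesis
    unfolding matching_def pairwise_def disjnt_def
  proof (intro ballI impI equals0I)
    fix d e f assume "d \<in> tensor_matching k N" "e \<in> tensor_matching k N" "d \<noteq> e" "f \<in> d \<inter> e"
    then show False using *[of d f] *[of e f] uniq[where f = f] by (metis IntE)
  qed
qed

text \<open>Counts vertices instead of edges: the covered tuples form a product of \<open>k\<close>
  sets of size \<open>2 * r\<close>, and each edge covers two of them.\<close>

lemma card_tensor_matching:
  assumes "k > 0" "\<And>l e. l < k \<Longrightarrow> e \<in> N l \<Longrightarrow> card e = 2"
    and "\<And>l. l < k \<Longrightarrow> matching (N l)" "\<And>l. l < k \<Longrightarrow> card (N l) = r"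
  shows "2 * card (tensor_matching k N) = (2 * r) ^ k"
proof -
  have "2 * card (tensor_matching k N) = card (\<Union>(tensor_matching k N))"
    using card_Union_matching[OF matching_tensor_matching[of k N]] card_tensor_edge[of k N] assms
    by simp
  also have "\<dots> = (\<Prod>l<k. card (\<Union>(N l)))"
    using assms(2) by (subst Union_tensor_matching) (auto simp: card_PiE)
  also have "\<dots> = (\<Prod>l<k. 2 * r)"
    by (rule prod.cong) (simp_all add: card_Union_matching assms)
  finally show ?thesis by simp
qed

section \<open>Equal-sum tuples and the tensor power of an ORS graph\<close>

text \<open>The \<open>t ^ k\<close> tuples share at most \<open>k * t\<close> possible sums. The
  pigeonhole bound is stated with one factor \<open>t\<close> cancelled and without division, to
  stay in the naturals.\<close>

lemma popular_sum:
  fixes k t :: nat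
  assumes "k > 0" "t > 0"
  obtains s where "t ^ (k - 1) \<le> k * card {I \<in> {..<k} \<rightarrow>\<^sub>E {1..t}. (\<Sum>l<k. I l) = s}"
proof -
  have "(\<Sum>l<k. I l) \<in> {1..k * t}" if I: "I \<in> {..<k} \<rightarrow>\<^sub>E {1..t}" for I
  proof -
    have "I l \<in> {1..t}" if "l < k" for l using I that by (auto simp: PiE_def Pi_def)
    then have "(\<Sum>l<k. 1) \<le> (\<Sum>l<k. I l)" "(\<Sum>l<k. I l) \<le> (\<Sum>l<k. t)"
      by (intro sum_mono; force)+
    then show ?thesis using assms(1) by simp
  qed
  then obtain s where "card ({..<k} \<rightarrow>\<^sub>E {1..t}) \<le>
      card ((\<lambda>I. \<Sum>l<k. I l) -` {s} \<inter> ({..<k} \<rightarrow>\<^sub>E {1..t})) * card {1..k * t}"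
    using pigeonhole_card[of "\<lambda>I. \<Sum>l<k. I l" "{..<k} \<rightarrow>\<^sub>E {1..t}" "{1..k * t}"] assms
    by (auto simp: finite_PiE)
  moreover have "(\<lambda>I. \<Sum>l<k. I l) -` {s} \<inter> ({..<k} \<rightarrow>\<^sub>E {1..t}) =
      {I \<in> {..<k} \<rightarrow>\<^sub>E {1..t}. (\<Sum>l<k. I l) = s}"
    by blast
  ultimately have "t ^ k \<le> card {I \<in> {..<k} \<rightarrow>\<^sub>E {1..t}. (\<Sum>l<k. I l) = s} * (k * t)"
    by (simp add: card_PiE)
  moreover have "t ^ k = t * t ^ (k - 1)" using assms(1) by (simp flip: power_Suc)
  ultimately have "t * t ^ (k - 1) \<le> t * (k * card {I \<in> {..<k} \<rightarrow>\<^sub>E {1..t}. (\<Sum>l<k. I l) = s})"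
    by (simp add: ac_simps)
  then show ?thesis using assms(2) that by simp
qed

lemma ors_graph_tensor_power:
  assumes "ors_graph V E r t" "k > 0" "t > 0"
  obtains E' :: "(nat \<Rightarrow> 'a) set set" and q
  where "rs_graph ({..<k} \<rightarrow>\<^sub>E V) E' ((2 * r) ^ k div 2) q" "t ^ (k - 1) \<le> k * q"
proof -
  obtain M where sg: "simple_graph V E" and mp: "matching_partition E r t M"
    and ord: "\<And>i j. i \<in> {1..t} \<Longrightarrow> j \<in> {1..t} \<Longrightarrow> i < j \<Longrightarrow> induced_edges E (\<Union>(M i)) \<inter> M j = {}"
    using assms(1) unfolding ors_graph_def by blast
  obtain s where s: "t ^ (k - 1) \<le> k * card {I \<in> {..<k} \<rightarrow>\<^sub>E {1..t}. (\<Sum>l<k. I l) = s}"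
    using popular_sum[OF assms(2,3)] by blast
  define A where "A = {I \<in> {..<k} \<rightarrow>\<^sub>E {1..t}. (\<Sum>l<k. I l) = s}"
  define T where "T I = tensor_matching k (\<lambda>l. M (I l))" for I
  have finA: "finite A" unfolding A_def by (simp add: finite_PiE)
  have A: "I l \<in> {1..t}" if "I \<in> A" "l < k" for I l
    using that by (auto simp: A_def PiE_def Pi_def)
  have ME: "M i \<subseteq> E" and Mm: "matching (M i)" and Mr: "card (M i) = r" if "i \<in> {1..t}" for i
    using mp that by (auto simp: matching_partition_def)
  have M2: "card e = 2" if "i \<in> {1..t}" "e \<in> M i" for i e
    using sg ME that by (auto simp: simple_graph_def)
  have Tm: "matching (T I)" if "I \<in> A" for I
    unfolding T_def by (rule matching_tensor_matching) (rule Mm[OF A[OF that]])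
  have Tc: "card (T I) = (2 * r) ^ k div 2" if "I \<in> A" for I
  proof -
    have "2 * card (T I) = (2 * r) ^ k"
      unfolding T_def
    proof (rule card_tensor_matching[OF assms(2)])
      fix l assume "l < k"
      then have l: "I l \<in> {1..t}" by (rule A[OF that])
      show "matching (M (I l))" "card (M (I l)) = r" using Mm[OF l] Mr[OF l] .
      show "card e = 2" if "e \<in> M (I l)" for e using M2[OF l that] .
    qed
    then show ?thesis by simp
  qed
  have TV: "\<Union>(T I) = (\<Pi>\<^sub>E l\<in>{..<k}. \<Union>(M (I l)))" if "I \<in> A" for I
    unfolding T_def by (rule Union_tensor_matching) (rule M2[OF A[OF that]])
  \<comment> \<open>This one fact gives both disjointness and inducedness of the family.\<close>
  have cross: "I = J" if I: "I \<in> A" and J: "J \<in> A" and e: "e \<in> T J" "e \<subseteq> \<Union>(T I)" for I J e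
  proof (rule ccontr)
    assume "I \<noteq> J"
    \<comment> \<open>Otherwise \<open>J\<close> lies below \<open>I\<close> everywhere and strictly
      somewhere, against the equal sums. This direction of the inequality is the one that the ORS
      condition speaks about.\<close>
    have "\<exists>l<k. I l < J l"
    proof (rule ccontr)
      assume "\<not> (\<exists>l<k. I l < J l)"
      then have le: "J l \<le> I l" if "l < k" for l using that by force
      obtain l where "l < k" "I l \<noteq> J l"
        using PiE_ext[of I "{..<k}" "\<lambda>_. {1..t}" J] I J \<open>I \<noteq> J\<close> by (auto simp: A_def)
      then have "(\<Sum>l<k. J l) < (\<Sum>l<k. I l)"
        using le by (intro sum_strict_mono_ex1) (auto intro!: bexI[of _ l] simp: order.strict_iff_order)
      then show False using I J by (simp add: A_def)
    qed
    then obtain l where l: "l < k" "I l < J l" by blast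
    \<comment> \<open>Projecting \<open>e\<close> to coordinate \<open>l\<close> gives an edge of
      the later matching \<open>M (J l)\<close> inside the vertex set of the earlier
      \<open>M (I l)\<close>.\<close>
    obtain f g where fg: "e = {f, g}" "{f l, g l} \<in> M (J l)"
      using e(1) l(1) by (auto simp: T_def tensor_matching_def)
    have "{f l, g l} \<subseteq> \<Union>(M (I l))"
      using e(2) l(1) unfolding fg(1) TV[OF I] by (auto simp: PiE_def Pi_def)
    then show False
      using ord[OF A[OF I l(1)] A[OF J l(1)] l(2)] fg(2) ME[OF A[OF J l(1)]]
      unfolding induced_edges_def by blast
  qed
  have "rs_graph ({..<k} \<rightarrow>\<^sub>E V) (\<Union>I\<in>A. T I) ((2 * r) ^ k div 2) (card A)"
  proof (rule rs_graph_of_indexed_family[OF _ finA Tm Tc])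
    show "simple_graph ({..<k} \<rightarrow>\<^sub>E V) (\<Union>I\<in>A. T I)"
      unfolding simple_graph_def
    proof (intro conjI ballI)
      show "finite ({..<k} \<rightarrow>\<^sub>E V)" using sg by (simp add: simple_graph_def finite_PiE)
      fix e assume "e \<in> (\<Union>I\<in>A. T I)"
      then obtain I where I: "I \<in> A" "e \<in> T I" by blast
      have "\<Union>(M (I l)) \<subseteq> V" if "l < k" for l
        using sg ME[OF A[OF I(1) that]] by (auto simp: simple_graph_def)
      then have "(\<Pi>\<^sub>E l\<in>{..<k}. \<Union>(M (I l))) \<subseteq> ({..<k} \<rightarrow>\<^sub>E V)"
        by (intro PiE_mono) auto
      then show "e \<subseteq> ({..<k} \<rightarrow>\<^sub>E V)" using TV[OF I(1)] I(2) by blast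
      show "card e = 2"
        using card_tensor_edge[OF assms(2) _ I(2)[unfolded T_def]] A[OF I(1)] M2 by blast
    qed
    \<comment> \<open>An edge common to \<open>T I\<close> and \<open>T J\<close> lies inside the
      vertex set of \<open>T I\<close>, so \<open>cross\<close> applies.\<close>
    show "disjoint_family_on T A"
      unfolding disjoint_family_on_def using cross by blast
    fix I assume I: "I \<in> A"
    have "induced_edges (\<Union>J\<in>A. T J) (\<Union>(T I)) = T I"
      unfolding induced_edges_def using cross I by blast
    then show "matching (induced_edges (\<Union>J\<in>A. T J) (\<Union>(T I)))" using Tm[OF I] by simp
  qed
  then show ?thesis using that s unfolding A_def by blast
qed

section \<open>From tensor powers to the asymptotic bound\<close>

lemma RS_power_ge_ORS:
  assumes "r > 0" "k > 0" "ORS N r > 0" "N ^ k \<le> n"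
  shows "ORS N r ^ (k - 1) \<le> k * RS n ((2 * r) ^ k div 2)"
proof -
  obtain V :: "nat set" and E where V: "card V = N" "ors_graph V E r (ORS N r)"
    using ORS_attained[OF assms(1)] by blast
  obtain E' :: "(nat \<Rightarrow> nat) set set" and q
    where q: "rs_graph ({..<k} \<rightarrow>\<^sub>E V) E' ((2 * r) ^ k div 2) q" "ORS N r ^ (k - 1) \<le> k * q"
    using ors_graph_tensor_power[OF V(2) assms(2,3)] by blast
  \<comment> \<open>Keeps the new matching size positive after halving, so that \<open>RS\<close> is
    a genuine maximum.\<close>
  have "2 \<le> (2 * r) ^ k"
    using assms(1,2) self_le_power[of "2 * r" k] by linarith
  then have "q \<le> RS n ((2 * r) ^ k div 2)"
    using V(1) assms(4) by (intro rs_graph_le_RS[OF q(1)]) (auto simp: card_PiE)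
  then show ?thesis using q(2) by (meson le_trans mult_le_mono2)
qed

text \<open>The integer \<open>k\<close>-th root: tensor powers only have \<open>N ^ k\<close>
  vertices, so a general \<open>n\<close> is rounded down to such a power and padded.\<close>

lemma nat_floor_root:
  fixes k n :: nat
  assumes "k > 0"
  obtains N where "N ^ k \<le> n" "n < (N + 1) ^ k"
proof -
  define m where "m = (LEAST m. n < m ^ k)"
  have "n < (n + 1) ^ k" using assms self_le_power[of "n + 1" k] by simp
  then have m: "n < m ^ k" unfolding m_def by (rule LeastI)
  then have "m \<noteq> 0" using assms by (metis not_less_zero zero_power)
  then obtain N where N: "m = N + 1" by (cases m) auto
  have "\<not> n < N ^ k" using not_less_Least[of N "\<lambda>m. n < m ^ k"] N unfolding m_def by simp
  then show ?thesis using that[of N] m N by simp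
qed

theorem theorem1:
  fixes \<epsilon> c :: real
  assumes "0 < \<epsilon>" and "\<epsilon> < 1" and "0 < c"
    and "\<exists>C::real. C > 0 \<and>
           (\<forall>\<^sub>F n in sequentially. real (ORS n (nat \<lfloor>\<epsilon> * real n\<rfloor>)) \<ge> C * real n powr c)"
  shows "\<forall>\<delta>::real. \<delta> > 0 \<longrightarrow>
           (\<exists>a b C' :: real. a > 0 \<and> b > 0 \<and> C' > 0 \<and>
             (\<forall>\<^sub>F n in sequentially. \<exists>r::nat.
                a * \<epsilon> powr (1 / \<delta>) * real n \<le> real r \<and>
                real r \<le> b * \<epsilon> powr (1 / \<delta>) * real n \<and>
                real (RS n r) \<ge> C' * real n powr (c * (1 - \<delta>))))"
proof (intro allI impI)
  fix \<delta> :: real assume \<delta>: "\<delta> > 0"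
  obtain C n0 where C: "C > 0"
    and ors: "\<And>N. N \<ge> n0 \<Longrightarrow> real (ORS N (nat \<lfloor>\<epsilon> * real N\<rfloor>)) \<ge> C * real N powr c"
    using assms(4) unfolding eventually_sequentially by blast
  \<comment> \<open>Chosen so that \<open>(k - 1) / k\<close> is at least
    \<open>1 - \<delta>\<close>. For \<open>\<delta> \<ge> 1\<close> this is \<open>k = 1\<close>,
    and the exponent \<open>k - 1\<close> vanishes.\<close>
  define k where "k = nat \<lceil>1 / \<delta>\<rceil>"
  have k_ge: "1 / \<delta> \<le> real k" unfolding k_def by linarith
  then have k: "k > 0"
    using \<delta> by (metis divide_pos_pos of_nat_0_less_iff order.strict_trans2 zero_less_one)
  define w where "w = \<epsilon> powr (1 / \<delta>)"
  have w: "w > 0" using assms(1) by (simp add: w_def)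
  \<comment> \<open>Dividing by \<open>w\<close> absorbs the constant ratio between
    \<open>\<epsilon> ^ k\<close> and \<open>\<epsilon> powr (1 / \<delta>)\<close>. The powers of 2
    in \<open>a\<close> and \<open>b\<close> pay for rounding \<open>\<epsilon> * N\<close> and the
    \<open>k\<close>-th root of \<open>n\<close>; \<open>C'\<close> pays for that root and for the
    pigeonhole factor \<open>k\<close>.\<close>
  define a where "a = (\<epsilon> / 2) ^ k / 2 / w"
  define b where "b = (2 * \<epsilon>) ^ k / 2 / w"
  define C' where "C' = (C / 2 powr c) ^ (k - 1) / real k"
  \<comment> \<open>From \<open>N \<ge> Z\<close> follow the assumed ORS bound at \<open>N\<close>,
    \<open>N \<ge> 1\<close>, and \<open>\<epsilon> * N \<ge> 2\<close>; the last makes the floor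
    lose at most half.\<close>
  define Z where "Z = max (max n0 1) (nat \<lceil>2 / \<epsilon>\<rceil>)"
  have "\<exists>r. a * w * real n \<le> real r \<and> real r \<le> b * w * real n \<and>
      real (RS n r) \<ge> C' * real n powr (c * (1 - \<delta>))" if n: "n \<ge> Z ^ k" for n
  proof -
    obtain N where N: "N ^ k \<le> n" "n < (N + 1) ^ k" using nat_floor_root[OF k] by blast
    have "Z ^ k < (N + 1) ^ k" using n N(2) by linarith
    then have NZ: "N \<ge> Z" using power_less_imp_less_base[of Z k "N + 1"] by simp
    then have N1: "N \<ge> 1" and Nn0: "N \<ge> n0" and "real N \<ge> 2 / \<epsilon>"
      unfolding Z_def by linarith+
    then have \<epsilon>N: "\<epsilon> * real N \<ge> 2" using assms(1) by (simp add: field_simps)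
    have "1 ^ k \<le> Z ^ k" unfolding Z_def by (intro power_mono) auto
    then have n1: "n \<ge> 1" using n by simp
    have Nup: "real N ^ k \<le> real n" using N(1) by (metis of_nat_le_iff of_nat_power)
    \<comment> \<open>\<open>N + 1 \<le> 2 * N\<close> turns the rounding of the root into a
      constant factor.\<close>
    have "n \<le> (2 * N) ^ k" using N(2) N1 power_mono[of "N + 1" "2 * N" k] by linarith
    then have nup: "real n \<le> (2 * real N) ^ k"
      by (metis of_nat_le_iff of_nat_mult of_nat_numeral of_nat_power)
    define r where "r = nat \<lfloor>\<epsilon> * real N\<rfloor>"
    have r: "\<epsilon> * real N / 2 \<le> real r" "real r \<le> \<epsilon> * real N" "r > 0"
      using \<epsilon>N unfolding r_def by linarith+
    define R where "R = (2 * r) ^ k div 2"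
    \<comment> \<open>Makes \<open>div 2\<close> exact, so \<open>R\<close> can be computed over the
      reals.\<close>
    have "even ((2 * r) ^ k)" using k by simp
    then have R: "real R = (2 * real r) ^ k / 2"
      unfolding R_def by (simp add: real_of_nat_div)
    have "a * w * real n = (\<epsilon> / 2) ^ k * real n / 2" using w by (simp add: a_def)
    also have "\<dots> \<le> (\<epsilon> / 2) ^ k * (2 * real N) ^ k / 2"
      using nup assms(1) by (intro divide_right_mono mult_left_mono) auto
    also have "\<dots> = (\<epsilon> * real N) ^ k / 2" by (simp add: power_mult_distrib power_divide)
    also have "\<dots> \<le> real R"
      unfolding R using r(1) assms(1) by (intro divide_right_mono power_mono) auto
    finally have lower: "a * w * real n \<le> real R" .
    have "real R \<le> (2 * (\<epsilon> * real N)) ^ k / 2"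
      unfolding R using r(2) by (intro divide_right_mono power_mono) auto
    also have "\<dots> = (2 * \<epsilon>) ^ k * real N ^ k / 2" by (simp add: power_mult_distrib)
    also have "\<dots> \<le> (2 * \<epsilon>) ^ k * real n / 2"
      using Nup assms(1) by (intro divide_right_mono mult_left_mono) auto
    also have "\<dots> = b * w * real n" using w by (simp add: b_def)
    finally have upper: "real R \<le> b * w * real n" .
    define t where "t = ORS N r"
    have t: "real t \<ge> C * real N powr c" using ors[OF Nn0] by (simp add: t_def r_def)
    then have "t > 0" using C N1 by (cases "t = 0") (auto simp: mult_le_0_iff)
    then have "t ^ (k - 1) \<le> k * RS n R"
      using RS_power_ge_ORS[OF r(3) k _ N(1)] by (simp add: t_def R_def)
    then have RS: "real t ^ (k - 1) \<le> real k * real (RS n R)"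
      by (metis of_nat_le_iff of_nat_mult of_nat_power)
    \<comment> \<open>Equivalent to \<open>1 / k \<le> \<delta>\<close>. Since
      \<open>n \<ge> 1\<close>, the exponent may be raised to \<open>c * (k - 1) / k\<close>, which
      the bound \<open>n \<le> (2 * N) ^ k\<close> turns into a \<open>(k - 1)\<close>-st power of
      \<open>(2 * N) powr c\<close>.\<close>
    have exps: "1 - \<delta> \<le> real (k - 1) / real k"
      using k_ge k \<delta> by (simp add: field_simps)
    have "real n powr (c * (1 - \<delta>)) \<le> real n powr (c * (real (k - 1) / real k))"
      using n1 exps assms(3) by (intro powr_mono mult_left_mono) auto
    also have "\<dots> \<le> ((2 * real N) ^ k) powr (c * (real (k - 1) / real k))"
      using nup assms(3) by (intro powr_mono2) auto
    also have "\<dots> = (2 * real N) powr (c * real (k - 1))"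
      using N1 k powr_realpow[of "2 * real N" k, symmetric] by (simp add: powr_powr)
    also have "\<dots> = ((2 * real N) powr c) ^ (k - 1)"
      using N1 by (simp add: powr_powr[symmetric] powr_realpow)
    also have "\<dots> = (2 powr c * real N powr c) ^ (k - 1)" by (simp add: powr_mult)
    finally have "C' * real n powr (c * (1 - \<delta>)) \<le> C' * (2 powr c * real N powr c) ^ (k - 1)"
      using C by (intro mult_left_mono) (auto simp: C'_def)
    also have "\<dots> = (C * real N powr c) ^ (k - 1) / real k"
      unfolding C'_def by (simp add: power_mult_distrib power_divide)
    also have "\<dots> \<le> real t ^ (k - 1) / real k"
      using t C by (intro divide_right_mono power_mono) auto
    also have "\<dots> \<le> real (RS n R)" using RS k by (simp add: field_simps)
    finally show ?thesis using lower upper by blast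
  qed
  then have "\<forall>\<^sub>F n in sequentially. \<exists>r. a * w * real n \<le> real r \<and> real r \<le> b * w * real n \<and>
      real (RS n r) \<ge> C' * real n powr (c * (1 - \<delta>))"
    unfolding eventually_sequentially by blast
  moreover have "a > 0" "b > 0" "C' > 0"
    using assms(1) w C k by (auto simp: a_def b_def C'_def)
  ultimately show "\<exists>a b C' :: real. a > 0 \<and> b > 0 \<and> C' > 0 \<and>
      (\<forall>\<^sub>F n in sequentially. \<exists>r::nat.
         a * \<epsilon> powr (1 / \<delta>) * real n \<le> real r \<and>
         real r \<le> b * \<epsilon> powr (1 / \<delta>) * real n \<and>
         real (RS n r) \<ge> C' * real n powr (c * (1 - \<delta>)))"
    unfolding w_def by blast
qed

end
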